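(* Fix $d\ge 3$, $c>0$ and $\frac{d-1}{d+1}<\delta<1$, let $p=(c+o_n(1))n^{-d+1+\delta}$, and let $\mathcal{H}$ be the random $d$-uniform hypergraph on $[n]$ with each $d$-subset a hyperedge independently with probability $p$. Then the partial recovery loss is $1-o_n(1)$.
   Context: $\mathrm{Proj}(H)$ is the graph on $[n]$ with $\{i,j\}$ an edge iff some hyperedge of $H$ contains $\{i,j\}$. The partial recovery loss is $\min_{\mathcal{B}}\mathbb{E}[|\mathcal{B}(\mathrm{Proj}(\mathcal{H}))\Delta E(\mathcal{H})|]/(p\binom{n}{d})$, the minimum over all functions $\mathcal{B}$ mapping projected graphs to sets of $d$-subsets of $[n]$. *)

theory Defs
  imports "HOL-Probability.Probability" "HOL-Library.Ramsey"
begin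

text \<open>
  A \<open>d\<close>-uniform hypergraph on \<open>[n] = {1..n}\<close> is identified with its edge set, a subset of
  \<open>nsets {1..n} d\<close> (the set of all \<open>d\<close>-element subsets of \<open>{1..n}\<close>); a graph on \<open>[n]\<close> is
  identified with its edge set, a subset of \<open>nsets {1..n} 2\<close>.
\<close>

definition proj :: "nat \<Rightarrow> nat set set \<Rightarrow> nat set set" where
  "proj n H = {e \<in> nsets {1..n} 2. \<exists>h\<in>H. e \<subseteq> h}"

definition projected_graphs :: "nat \<Rightarrow> nat \<Rightarrow> nat set set set" where
  "projected_graphs n d = proj n ` Pow (nsets {1..n} d)"

text \<open>
  The indicators of the \<open>d\<close>-subsets are independent Bernoulli variables. The constant
  \<open>bernoulli_pmf\<close> truncates its parameter to \<open>[0, 1]\<close>.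
\<close>

definition random_hypergraph :: "nat \<Rightarrow> nat \<Rightarrow> real \<Rightarrow> nat set set pmf" where
  "random_hypergraph n d p =
     map_pmf (\<lambda>X. {h \<in> nsets {1..n} d. X h})
       (Pi_pmf (nsets {1..n} d) False (\<lambda>_. bernoulli_pmf p))"

text \<open>
  The functions are taken extensional (\<open>\<rightarrow>\<^sub>E\<close>), so that there are only finitely many of
  them and \<open>Min\<close> is a genuine minimum.
\<close>

definition recovery_maps :: "nat \<Rightarrow> nat \<Rightarrow> (nat set set \<Rightarrow> nat set set) set" where
  "recovery_maps n d = projected_graphs n d \<rightarrow>\<^sub>E Pow (nsets {1..n} d)"

definition partial_recovery_loss :: "nat \<Rightarrow> nat \<Rightarrow> real \<Rightarrow> real" where
  "partial_recovery_loss n d p =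
     Min ((\<lambda>B. measure_pmf.expectation (random_hypergraph n d p)
                 (\<lambda>H. real (card (sym_diff (B (proj n H)) H)))) ` recovery_maps n d)
     / (p * real (n choose d))"

lemma finite_recovery_maps: "finite (recovery_maps n d)"
  unfolding recovery_maps_def projected_graphs_def
  by (intro finite_PiE finite_imageI) (auto intro: finite_imp_finite_nsets)

lemma recovery_maps_nonempty: "recovery_maps n d \<noteq> {}"
  unfolding recovery_maps_def by (auto simp: PiE_eq_empty_iff)

end

theory Submission
  imports Defs
begin

text \<open>
  The trivial guess \<open>{}\<close> has loss \<open>1\<close>. For the lower bound, an arbitrary guess \<open>B\<close> yields an
  encoding of the hypergraph \<open>H\<close>: first describe the graph \<open>G = proj n H\<close> as a set of pairs of density
  \<open>q = n powr (\<delta> - 1)\<close>, then describe the positions among the cliques of \<open>G\<close> at which \<open>B G\<close> is wrong.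
  With \<open>M\<close> the expected number of hyperedges, the first part costs about
  \<open>M * (d choose 2) * (1 - \<delta>) * ln n\<close>, and each error costs about \<open>a * ln n\<close>, where \<open>n powr a\<close> is the
  number of cliques of \<open>G\<close> per hyperedge. The entropy of \<open>H\<close> is about \<open>M * (d - 1 - \<delta>) * ln n\<close>,
  which exceeds the cost of \<open>G\<close> by exactly \<open>M * a * ln n\<close>; hence there must be at least
  \<open>(1 - o(1)) * M\<close> errors.
\<close>

section \<open>Counting subsets and Gibbs' inequality\<close>

declare finite_imp_finite_nsets [simp]

lemma card_nsets: "finite A \<Longrightarrow> card (nsets A k) = card A choose k"
  unfolding nsets_def
  by (subst n_subsets[symmetric]) (auto intro!: arg_cong[where f = card] intro: finite_subset)

text \<open>Symmetric difference with \<open>B\<close> is an involution of \<open>Pow C\<close>, so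
  \<open>B\<close> may be replaced by \<open>{}\<close> and the sum becomes a product over
  \<open>C\<close>. This normalises both stages of the encoding.\<close>

lemma sum_power_card_sym_diff:
  fixes r :: real
  assumes "finite C" "B \<subseteq> C"
  shows "(\<Sum>X\<in>Pow C. r ^ card (sym_diff B X)) = (1 + r) ^ card C"
proof -
  have "(\<Sum>X\<in>Pow C. r ^ card (sym_diff B X)) = (\<Sum>X\<in>Pow C. r ^ card X)"
    by (rule sum.reindex_bij_witness[where i = "sym_diff B" and j = "sym_diff B"])
       (use assms in \<open>auto 4 4\<close>)
  also have "\<dots> = (\<Prod>x\<in>C. r + 1)"
    using prod_add[OF assms(1), of "\<lambda>_. r" "\<lambda>_. 1"] by simp
  finally show ?thesis
    by (simp add: add.commute)
qed

text \<open>Gibbs' inequality, from \<open>ln t \<le> t - 1\<close> at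
  \<open>t = Q x / pmf M x\<close>. Mass at most 1 suffices, so \<open>Q\<close> may waste weight on
  objects that never occur.\<close>

lemma expectation_ln_le_expectation_ln_pmf:
  fixes M :: "'a pmf" and Q :: "'a \<Rightarrow> real"
  assumes fin: "finite (set_pmf M)"
    and pos: "\<And>x. x \<in> set_pmf M \<Longrightarrow> Q x > 0"
    and le: "sum Q (set_pmf M) \<le> 1"
  shows "measure_pmf.expectation M (\<lambda>x. ln (Q x)) \<le> measure_pmf.expectation M (\<lambda>x. ln (pmf M x))"
proof -
  have "(\<Sum>x\<in>set_pmf M. pmf M x * ln (Q x)) - (\<Sum>x\<in>set_pmf M. pmf M x * ln (pmf M x)) =
        (\<Sum>x\<in>set_pmf M. pmf M x * ln (Q x / pmf M x))"
    unfolding sum_subtractf[symmetric]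
  proof (rule sum.cong)
    fix x assume "x \<in> set_pmf M"
    then have "Q x > 0" "pmf M x > 0"
      by (auto simp: pos pmf_positive)
    then show "pmf M x * ln (Q x) - pmf M x * ln (pmf M x) = pmf M x * ln (Q x / pmf M x)"
      by (simp add: ln_div right_diff_distrib)
  qed simp
  also have "\<dots> \<le> (\<Sum>x\<in>set_pmf M. pmf M x * (Q x / pmf M x - 1))"
    by (intro sum_mono mult_left_mono ln_le_minus_one divide_pos_pos) (auto simp: pos pmf_positive)
  also have "\<dots> = sum Q (set_pmf M) - (\<Sum>x\<in>set_pmf M. pmf M x)"
    by (simp add: sum_subtractf[symmetric] right_diff_distrib)
       (auto intro!: sum.cong simp: set_pmf_iff)
  also have "\<dots> \<le> 0"
    using le sum_pmf_eq_1[OF fin] by simp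
  finally show ?thesis
    by (simp add: integral_measure_pmf[OF fin])
qed

subsection \<open>The random hypergraph\<close>

lemma set_random_hypergraph: "set_pmf (random_hypergraph n d p) \<subseteq> Pow (nsets {1..n} d)"
  unfolding random_hypergraph_def by auto

lemma finite_set_random_hypergraph [simp]: "finite (set_pmf (random_hypergraph n d p))"
  by (rule finite_subset[OF set_random_hypergraph]) simp

lemma integrable_random_hypergraph [simp]:
  "integrable (random_hypergraph n d p) (f :: nat set set \<Rightarrow> real)"
  by (simp add: integrable_measure_pmf_finite)

lemma prob_random_hypergraph_superset:
  assumes "E \<subseteq> nsets {1..n} d" "0 \<le> p" "p \<le> 1"
  shows "measure_pmf.prob (random_hypergraph n d p) {H. E \<subseteq> H} = p ^ card E"
proof -
  let ?V = "nsets {1..n} d" and ?B = "\<lambda>h. if h \<in> E then {True} else UNIV"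
  have "measure_pmf.prob (random_hypergraph n d p) {H. E \<subseteq> H} =
        measure_pmf.prob (Pi_pmf ?V False (\<lambda>_. bernoulli_pmf p)) (Pi ?V ?B)"
    unfolding random_hypergraph_def measure_map_pmf
    using assms(1) by (intro arg_cong[where f = "measure_pmf.prob _"]) (auto simp: Pi_def)
  also have "\<dots> = (\<Prod>h\<in>?V. measure_pmf.prob (bernoulli_pmf p) (?B h))"
    by (rule measure_Pi_pmf_Pi) simp
  also have "\<dots> = (\<Prod>h\<in>?V. if h \<in> E then p else 1)"
    using assms(2,3) by (intro prod.cong) (auto simp: measure_pmf_single)
  also have "\<dots> = p ^ card E"
    using assms(1) by (simp add: prod.If_cases Int_absorb1)
  finally show ?thesis .
qed

text \<open>Dropping the factors \<open>1 - p\<close> of the absent hyperedges leaves a bound whose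
  logarithm is linear in \<open>card H\<close>.\<close>

lemma pmf_random_hypergraph_le:
  assumes "H \<subseteq> nsets {1..n} d" "0 \<le> p" "p \<le> 1"
  shows "pmf (random_hypergraph n d p) H \<le> p ^ card H"
proof -
  have "pmf (random_hypergraph n d p) H \<le>
        measure_pmf.prob (random_hypergraph n d p) {H'. H \<subseteq> H'}"
    unfolding measure_pmf_single[symmetric]
    by (rule measure_pmf.finite_measure_mono) auto
  then show ?thesis
    using prob_random_hypergraph_superset[OF assms] by simp
qed

lemma expectation_card_random_set:
  fixes M :: "'a pmf"
  assumes "finite V" "finite (set_pmf M)"
    and "\<And>x. x \<in> set_pmf M \<Longrightarrow> S x \<subseteq> V"
  shows "measure_pmf.expectation M (\<lambda>x. real (card (S x))) =
         (\<Sum>v\<in>V. measure_pmf.prob M {x. v \<in> S x})"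
proof -
  have "measure_pmf.expectation M (\<lambda>x. real (card (S x))) =
        measure_pmf.expectation M (\<lambda>x. \<Sum>v\<in>V. indicator {x. v \<in> S x} x)"
    using assms(1,3)
    by (intro integral_cong_AE)
       (auto simp: AE_measure_pmf_iff indicator_def sum.If_cases intro!: arg_cong[where f = card])
  also have "\<dots> = (\<Sum>v\<in>V. measure_pmf.prob M {x. v \<in> S x})"
    by (simp add: integrable_measure_pmf_finite[OF assms(2)])
  finally show ?thesis .
qed

lemma expectation_card_random_hypergraph:
  assumes "0 \<le> p" "p \<le> 1"
  shows "measure_pmf.expectation (random_hypergraph n d p) (\<lambda>H. real (card H)) =
         p * real (n choose d)"
proof -
  have "measure_pmf.expectation (random_hypergraph n d p) (\<lambda>H. real (card H)) =
        (\<Sum>h\<in>nsets {1..n} d. measure_pmf.prob (random_hypergraph n d p) {H. h \<in> H})"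
    using set_random_hypergraph[of n d p] by (intro expectation_card_random_set) auto
  also have "\<dots> = (\<Sum>h\<in>nsets {1..n} d. p)"
    using prob_random_hypergraph_superset[of "{_}" n d p] assms by (intro sum.cong) auto
  finally show ?thesis
    by (simp add: card_nsets)
qed

subsection \<open>Cliques of the projected graph\<close>

text \<open>The candidate hyperedges once the projection is known. Locating errors within this set,
  not among all \<open>d\<close>-subsets, is what brings the cost of an error down to about
  \<open>a * ln n\<close>.\<close>

definition cliques :: "nat \<Rightarrow> nat \<Rightarrow> nat set set \<Rightarrow> nat set set" where
  "cliques n d G = {h \<in> nsets {1..n} d. nsets h 2 \<subseteq> G}"

lemma finite_cliques [simp]: "finite (cliques n d G)"
  by (simp add: cliques_def)

lemma subset_cliques_proj: "H \<subseteq> nsets {1..n} d \<Longrightarrow> H \<subseteq> cliques n d (proj n H)"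
  unfolding cliques_def proj_def nsets_def by blast

text \<open>A hyperedge with trace \<open>S\<close> is determined by its part outside
  \<open>h\<close>, which has \<open>d - card S\<close> elements.\<close>

lemma card_traces_le:
  assumes "finite h" "S \<subseteq> h" "card S \<le> d"
  shows "card {e \<in> nsets {1..n} d. e \<inter> h = S} \<le> n ^ (d - card S)"
proof -
  have fS: "finite S"
    using assms finite_subset by auto
  have inj: "inj_on (\<lambda>e. e - h) {e \<in> nsets {1..n} d. e \<inter> h = S}"
    by (rule inj_onI) (metis (mono_tags, lifting) Int_Diff_Un mem_Collect_eq)
  have "card {e \<in> nsets {1..n} d. e \<inter> h = S} =
        card ((\<lambda>e. e - h) ` {e \<in> nsets {1..n} d. e \<inter> h = S})"
    using inj by (simp add: card_image)
  also have "\<dots> \<le> card (nsets {1..n} (d - card S))"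
    using fS by (intro card_mono)
       (auto simp: nsets_def card_Diff_subset_Int)
  also have "\<dots> = n choose (d - card S)"
    by (simp add: card_nsets)
  also have "\<dots> \<le> n ^ (d - card S)"
    by (cases "d - card S \<le> n") (auto intro: binomial_le_pow simp: binomial_eq_0)
  finally show ?thesis .
qed

text \<open>
  If the pairs in \<open>h\<close> are all covered, then they are covered by the family \<open>F\<close> of traces \<open>e \<inter> h\<close>
  of the hyperedges \<open>e\<close>. Hyperedges with distinct traces are distinct, so a union bound over \<open>F\<close> and
  over a choice of one hyperedge for each trace suffices.
\<close>
lemma prob_covered_le:
  fixes q \<kappa> :: real
  assumes p: "0 \<le> p" "p \<le> 1" and q: "0 < q" "q \<le> 1" and \<kappa>: "\<kappa> \<ge> 1"
    and trace: "\<And>s. 2 \<le> s \<Longrightarrow> s \<le> d \<Longrightarrow> real n ^ (d - s) * p \<le> \<kappa> * q ^ (s choose 2)"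
    and h: "h \<in> nsets {1..n} d"
  shows "measure_pmf.prob (random_hypergraph n d p) {H. nsets h 2 \<subseteq> proj n H}
         \<le> 2 ^ 2 ^ d * \<kappa> ^ 2 ^ d * q ^ (d choose 2)"
proof -
  let ?M = "random_hypergraph n d p"
  \<comment> \<open>Smaller traces cover no pair. There are at most \<open>2 ^ d\<close> traces,
    hence at most \<open>2 ^ 2 ^ d\<close> families; this is the source of both constants in the
    bound.\<close>
  define T where "T = {S. S \<subseteq> h \<and> 2 \<le> card S}"
  define \<F> where "\<F> = {F. F \<subseteq> T \<and> nsets h 2 \<subseteq> (\<Union>S\<in>F. nsets S 2)}"
  define V where "V = (\<lambda>S. {e \<in> nsets {1..n} d. e \<inter> h = S})"
  have fh: "finite h" and ch: "card h = d" and hn: "h \<subseteq> {1..n}"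
    using h by (auto simp: nsets_def)
  have T: "T \<subseteq> Pow h" and fT: "finite T"
    using fh by (auto simp: T_def)
  have cT: "card T \<le> 2 ^ d"
    using card_mono[OF _ T] fh ch by (simp add: card_Pow)
  have \<F>: "\<F> \<subseteq> Pow T" and f\<F>: "finite \<F>"
    using fT by (auto simp: \<F>_def)
  have c\<F>: "card \<F> \<le> 2 ^ 2 ^ d"
  proof -
    have "card \<F> \<le> 2 ^ card T"
      using card_mono[OF _ \<F>] fT by (simp add: card_Pow)
    also have "\<dots> \<le> 2 ^ 2 ^ d"
      using cT by (intro power_increasing) auto
    finally show ?thesis .
  qed
  have fF: "finite F" if "F \<in> \<F>" for F
    using that fT finite_subset by (auto simp: \<F>_def)
  have fV: "finite (V S)" for S
    by (simp add: V_def)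
  have cover: "\<exists>F\<in>\<F>. \<exists>\<phi>\<in>Pi\<^sub>E F V. \<phi> ` F \<subseteq> H"
    if H: "H \<subseteq> nsets {1..n} d" and cov: "nsets h 2 \<subseteq> proj n H" for H
  proof -
    define F where "F = {S\<in>T. \<exists>e\<in>H. e \<inter> h = S}"
    have "nsets h 2 \<subseteq> (\<Union>S\<in>F. nsets S 2)"
    proof
      fix u assume u: "u \<in> nsets h 2"
      then obtain e where e: "e \<in> H" "u \<subseteq> e"
        using cov by (auto simp: proj_def)
      have "u \<subseteq> e \<inter> h" "card u = 2" "finite u"
        using u e by (auto simp: nsets_def)
      moreover from this have "2 \<le> card (e \<inter> h)"
        using fh by (metis card_mono finite_Int)
      ultimately show "u \<in> (\<Union>S\<in>F. nsets S 2)"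
        using e unfolding F_def T_def nsets_def by blast
    qed
    then have F: "F \<in> \<F>"
      by (auto simp: \<F>_def F_def)
    have "\<forall>S\<in>F. \<exists>e. e \<in> H \<and> e \<in> V S"
      using H by (auto simp: F_def V_def)
    then obtain \<phi> where \<phi>: "\<forall>S\<in>F. \<phi> S \<in> H \<and> \<phi> S \<in> V S"
      by metis
    then show ?thesis
      by (intro bexI[OF _ F] bexI[of _ "restrict \<phi> F"]) auto
  qed
  have "measure_pmf.prob ?M {H. nsets h 2 \<subseteq> proj n H} \<le>
        measure_pmf.prob ?M (\<Union>F\<in>\<F>. \<Union>\<phi>\<in>Pi\<^sub>E F V. {H. \<phi> ` F \<subseteq> H})"
    using cover set_random_hypergraph[of n d p]
    by (intro measure_pmf.finite_measure_mono_AE) (auto simp: AE_measure_pmf_iff)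
  also have "\<dots> \<le> (\<Sum>F\<in>\<F>. measure_pmf.prob ?M (\<Union>\<phi>\<in>Pi\<^sub>E F V. {H. \<phi> ` F \<subseteq> H}))"
    using f\<F> by (intro measure_pmf.finite_measure_subadditive_finite) auto
  also have "\<dots> \<le> (\<Sum>F\<in>\<F>. \<kappa> ^ 2 ^ d * q ^ (d choose 2))"
  proof (rule sum_mono)
    fix F assume F: "F \<in> \<F>"
    have FT: "F \<subseteq> T" and Fcov: "nsets h 2 \<subseteq> (\<Union>S\<in>F. nsets S 2)"
      using F by (auto simp: \<F>_def)
    have "measure_pmf.prob ?M (\<Union>\<phi>\<in>Pi\<^sub>E F V. {H. \<phi> ` F \<subseteq> H}) \<le>
          (\<Sum>\<phi>\<in>Pi\<^sub>E F V. measure_pmf.prob ?M {H. \<phi> ` F \<subseteq> H})"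
      by (intro measure_pmf.finite_measure_subadditive_finite)
         (auto intro!: finite_PiE simp: fF[OF F] fV)
    also have "\<dots> = (\<Sum>\<phi>\<in>Pi\<^sub>E F V. p ^ card F)"
    proof (rule sum.cong)
      fix \<phi> assume \<phi>: "\<phi> \<in> Pi\<^sub>E F V"
      have tr: "\<phi> S \<in> nsets {1..n} d" "\<phi> S \<inter> h = S" if "S \<in> F" for S
        using \<phi> that by (auto simp: V_def PiE_def Pi_def)
      have "inj_on \<phi> F"
        by (rule inj_onI) (metis tr(2))
      then show "measure_pmf.prob ?M {H. \<phi> ` F \<subseteq> H} = p ^ card F"
        using tr(1) p by (subst prob_random_hypergraph_superset) (auto simp: card_image)
    qed simp
    \<comment> \<open>The number of choices \<open>\<phi>\<close> factors over \<open>F\<close>, so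
      each trace can be bounded separately.\<close>
    also have "\<dots> = (\<Prod>S\<in>F. real (card (V S)) * p)"
      using fF[OF F] by (simp add: card_PiE prod.distrib)
    also have "\<dots> \<le> (\<Prod>S\<in>F. \<kappa> * q ^ (card S choose 2))"
    proof (intro prod_mono conjI)
      fix S assume "S \<in> F"
      then have S: "S \<subseteq> h" "2 \<le> card S"
        using FT by (auto simp: T_def)
      moreover have Sd: "card S \<le> d"
        using S fh ch by (metis card_mono)
      ultimately have "real (card (V S)) \<le> real n ^ (d - card S)"
        using card_traces_le[of h S d n] fh by (simp add: V_def flip: of_nat_power)
      then have "real (card (V S)) * p \<le> real n ^ (d - card S) * p"
        using p by (intro mult_right_mono)
      then show "real (card (V S)) * p \<le> \<kappa> * q ^ (card S choose 2)"
        using trace[OF S(2) Sd] by simp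
    qed (use p in auto)
    also have "\<dots> = \<kappa> ^ card F * q ^ (\<Sum>S\<in>F. card S choose 2)"
      by (simp add: prod.distrib power_sum)
    also have "\<dots> \<le> \<kappa> ^ 2 ^ d * q ^ (d choose 2)"
    proof (rule mult_mono)
      have "card F \<le> 2 ^ d"
        using card_mono[OF fT FT] cT by simp
      then show "\<kappa> ^ card F \<le> \<kappa> ^ 2 ^ d"
        using \<kappa> by (rule power_increasing)
      have fS: "finite S" if "S \<in> F" for S
        using that FT T fh by (meson PowD finite_subset subsetD)
      \<comment> \<open>As \<open>F\<close> covers every pair in \<open>h\<close>, the exponents sum
        to at least \<open>d choose 2\<close>; \<open>q \<le> 1\<close> turns this into an upper
        bound.\<close>
      have "d choose 2 = card (nsets h 2)"
        by (simp add: card_nsets fh ch)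
      also have "\<dots> \<le> card (\<Union>S\<in>F. nsets S 2)"
        using fF[OF F] fS by (intro card_mono Fcov) auto
      also have "\<dots> \<le> (\<Sum>S\<in>F. card (nsets S 2))"
        using fF[OF F] by (rule card_UN_le)
      also have "\<dots> = (\<Sum>S\<in>F. card S choose 2)"
        using fS by (intro sum.cong) (auto simp: card_nsets)
      finally show "q ^ (\<Sum>S\<in>F. card S choose 2) \<le> q ^ (d choose 2)"
        using q by (intro power_decreasing) auto
    qed (use \<kappa> q in auto)
    finally show "measure_pmf.prob ?M (\<Union>\<phi>\<in>Pi\<^sub>E F V. {H. \<phi> ` F \<subseteq> H})
                  \<le> \<kappa> ^ 2 ^ d * q ^ (d choose 2)" .
  qed
  also have "\<dots> = real (card \<F>) * (\<kappa> ^ 2 ^ d * q ^ (d choose 2))"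
    by simp
  also have "\<dots> \<le> 2 ^ 2 ^ d * (\<kappa> ^ 2 ^ d * q ^ (d choose 2))"
  proof (rule mult_right_mono)
    show "real (card \<F>) \<le> 2 ^ 2 ^ d"
      using c\<F> of_nat_le_iff[of "card \<F>" "2 ^ 2 ^ d", where ?'a = real] by simp
  qed (use \<kappa> q in auto)
  finally show ?thesis
    by (simp add: mult.assoc)
qed

text \<open>By linearity over the \<open>d\<close>-subsets: up to a constant factor, there are at
  most as many cliques as in a graph with independent edges of density \<open>q\<close>.\<close>

lemma expectation_card_cliques_le:
  fixes q \<kappa> :: real
  assumes p: "0 \<le> p" "p \<le> 1" and q: "0 < q" "q \<le> 1" and \<kappa>: "\<kappa> \<ge> 1"
    and trace: "\<And>s. 2 \<le> s \<Longrightarrow> s \<le> d \<Longrightarrow> real n ^ (d - s) * p \<le> \<kappa> * q ^ (s choose 2)"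
  shows "measure_pmf.expectation (random_hypergraph n d p)
           (\<lambda>H. real (card (cliques n d (proj n H))))
         \<le> real (n choose d) * (2 ^ 2 ^ d * \<kappa> ^ 2 ^ d * q ^ (d choose 2))"
proof -
  have "measure_pmf.expectation (random_hypergraph n d p)
          (\<lambda>H. real (card (cliques n d (proj n H)))) =
        (\<Sum>h\<in>nsets {1..n} d. measure_pmf.prob (random_hypergraph n d p)
                              {H. h \<in> cliques n d (proj n H)})"
    by (intro expectation_card_random_set) (auto simp: cliques_def)
  also have "\<dots> \<le> (\<Sum>h\<in>nsets {1..n} d. 2 ^ 2 ^ d * \<kappa> ^ 2 ^ d * q ^ (d choose 2))"
    using prob_covered_le[OF assms] by (intro sum_mono) (simp add: cliques_def)
  finally show ?thesis
    by (simp add: card_nsets)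
qed

subsection \<open>Lower bound on the loss\<close>

text \<open>Lets the cost of describing the graph be charged to the hyperedges, whose expected
  number is known.\<close>

lemma card_proj_le:
  assumes "H \<subseteq> nsets {1..n} d"
  shows "card (proj n H) \<le> (d choose 2) * card H"
proof -
  have H: "finite H"
    using assms by (rule finite_subset) simp
  have h: "finite h" "card h = d" if "h \<in> H" for h
    using assms that by (auto simp: nsets_def)
  have "card (proj n H) \<le> card (\<Union>h\<in>H. nsets h 2)"
    using H h by (intro card_mono) (auto simp: proj_def nsets_def)
  also have "\<dots> \<le> (\<Sum>h\<in>H. card (nsets h 2))"
    using H by (rule card_UN_le)
  also have "\<dots> = (d choose 2) * card H"
    using h by (simp add: card_nsets)
  finally show ?thesis .
qed

text \<open>
  Gibbs' inequality compares the law of the hypergraph with the sub-probability \<open>Q\<close> that first draws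
  the graph by independent pairs of weight \<open>q\<close>, and then modifies the guess \<open>B\<close> by independent
  changes of weight \<open>r\<close> within the set of cliques.
\<close>
lemma recovery_information_inequality:
  fixes q r :: real
  assumes p: "0 < p" "p \<le> 1" and q: "0 < q" "q \<le> 1" and r: "0 < r" "r \<le> 1"
    and B: "B \<in> recovery_maps n d"
  defines "M \<equiv> random_hypergraph n d p"
  shows "p * real (n choose d) * (ln (1 / p) - real (d choose 2) * ln (1 / q)) \<le>
           real (n choose 2) * q
         + r * measure_pmf.expectation M (\<lambda>H. real (card (cliques n d (proj n H))))
         + ln (1 / r) * measure_pmf.expectation M (\<lambda>H. real (card (sym_diff (B (proj n H)) H)))"
proof -
  let ?V = "nsets {1..n} d" and ?E = "nsets {1..n} 2"
  let ?cl = "\<lambda>g. card (cliques n d g)" and ?D = "\<lambda>H. card (sym_diff (B (proj n H)) H)"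
  \<comment> \<open>\<open>q\<close> and \<open>r\<close> act as odds: a pair is present with
    probability \<open>q / (1 + q)\<close>. Normalisation then costs only
    \<open>ln (1 + q) \<le> q\<close> per pair and \<open>ln (1 + r) \<le> r\<close> per
    clique.\<close>
  define R where "R = (\<lambda>g :: nat set set. q ^ card g / (1 + q) ^ (n choose 2))"
  define Q where "Q = (\<lambda>H. R (proj n H) * (r ^ ?D H / (1 + r) ^ ?cl (proj n H)))"
  have supp: "set_pmf M \<subseteq> Pow ?V" and fin: "finite (set_pmf M)"
    using set_random_hypergraph[of n d p] by (simp_all add: M_def)
  have int [simp]: "integrable M f" for f :: "_ \<Rightarrow> real"
    by (simp add: M_def)
  have R0: "R g > 0" for g
    using q by (simp add: R_def)
  have Q0: "Q H > 0" for H
    using r R0 by (simp add: Q_def)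
  have projE: "proj n H \<subseteq> ?E" for H
    by (auto simp: proj_def)
  have B': "B (proj n H) \<subseteq> ?V" if "H \<subseteq> ?V" for H
    using B that by (auto simp: recovery_maps_def projected_graphs_def PiE_def Pi_def)

  \<comment> \<open>Guessed sets outside \<open>?C\<close> are always errors, because
    \<open>H\<close> lies within \<open>?C\<close>. Discarding them only raises the weight, and the
    weights over all of \<open>Pow ?C\<close> are normalised.\<close>
  have fibre: "sum Q {H \<in> Pow ?V. proj n H = g} \<le> R g" for g
  proof -
    let ?C = "cliques n d g"
    have "sum Q {H \<in> Pow ?V. proj n H = g} \<le>
          (\<Sum>H\<in>{H \<in> Pow ?V. proj n H = g}.
             R g * (r ^ card (sym_diff (B g \<inter> ?C) H) / (1 + r) ^ ?cl g))"
    proof (rule sum_mono)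
      fix H assume "H \<in> {H \<in> Pow ?V. proj n H = g}"
      then have H: "H \<subseteq> ?V" and g: "g = proj n H"
        by auto
      have "finite (sym_diff (B g) H)"
        using H B'[OF H] finite_subset[of _ ?V] by (auto simp: g)
      then have "card (sym_diff (B g \<inter> ?C) H) \<le> card (sym_diff (B g) H)"
        using subset_cliques_proj[OF H] by (intro card_mono) (auto simp: g)
      then have "r ^ card (sym_diff (B g) H) \<le> r ^ card (sym_diff (B g \<inter> ?C) H)"
        using r by (intro power_decreasing) auto
      then show "Q H \<le> R g * (r ^ card (sym_diff (B g \<inter> ?C) H) / (1 + r) ^ ?cl g)"
        unfolding Q_def g using R0 r
        by (intro mult_left_mono divide_right_mono) (auto simp: less_imp_le)
    qed
    also have "\<dots> \<le> (\<Sum>H\<in>Pow ?C.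
             R g * (r ^ card (sym_diff (B g \<inter> ?C) H) / (1 + r) ^ ?cl g))"
    proof (rule sum_mono2)
      show "{H \<in> Pow ?V. proj n H = g} \<subseteq> Pow ?C"
        using subset_cliques_proj[of _ n d] by blast
    qed (use R0[of g] r in auto)
    also have "\<dots> = R g * ((\<Sum>H\<in>Pow ?C. r ^ card (sym_diff (B g \<inter> ?C) H)) / (1 + r) ^ ?cl g)"
      by (simp only: sum_distrib_left sum_divide_distrib)
    also have "(\<Sum>H\<in>Pow ?C. r ^ card (sym_diff (B g \<inter> ?C) H)) = (1 + r) ^ ?cl g"
      by (rule sum_power_card_sym_diff) auto
    finally show ?thesis
      using r by simp
  qed
  have "sum Q (set_pmf M) \<le> sum Q (Pow ?V)"
    using supp Q0 by (intro sum_mono2) (auto simp: less_imp_le)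
  also have "\<dots> = (\<Sum>g\<in>Pow ?E. sum Q {H \<in> Pow ?V. proj n H = g})"
    using projE by (intro sum.group[symmetric]) auto
  also have "\<dots> \<le> sum R (Pow ?E)"
    by (intro sum_mono fibre)
  also have "\<dots> = 1"
    using sum_power_card_sym_diff[of ?E "{}" q] q
    by (simp add: R_def card_nsets flip: sum_divide_distrib)
  finally have gibbs: "measure_pmf.expectation M (\<lambda>H. ln (Q H)) \<le>
      measure_pmf.expectation M (\<lambda>H. ln (pmf M H))"
    using fin Q0 by (intro expectation_ln_le_expectation_ln_pmf) auto

  \<comment> \<open>A lower bound for \<open>ln (Q H)\<close> that is linear in the numbers of
    hyperedges, errors and cliques, so that only their expectations enter.\<close>
  have "measure_pmf.expectation M (\<lambda>H. real (d choose 2) * ln q * real (card H)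
          - real (n choose 2) * q + ln r * real (?D H) - r * real (?cl (proj n H)))
        \<le> measure_pmf.expectation M (\<lambda>H. ln (Q H))"
  proof (rule integral_mono_AE)
    show "AE H in M. real (d choose 2) * ln q * real (card H)
          - real (n choose 2) * q + ln r * real (?D H) - r * real (?cl (proj n H)) \<le> ln (Q H)"
    proof (rule AE_pmfI)
      fix H assume "H \<in> set_pmf M"
      then have H: "H \<subseteq> ?V"
        using supp by auto
      have "real (card (proj n H)) \<le> real (d choose 2) * real (card H)"
        using card_proj_le[OF H] by (simp flip: of_nat_mult)
      then have 1: "real (d choose 2) * real (card H) * ln q \<le> real (card (proj n H)) * ln q"
        using q by (intro mult_right_mono_neg) auto
      have 2: "real (n choose 2) * ln (1 + q) \<le> real (n choose 2) * q"
        using q by (intro mult_left_mono ln_add_one_self_le_self) auto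
      have 3: "real (?cl (proj n H)) * ln (1 + r) \<le> real (?cl (proj n H)) * r"
        using r by (intro mult_left_mono ln_add_one_self_le_self) auto
      have "ln (Q H) = real (card (proj n H)) * ln q - real (n choose 2) * ln (1 + q)
          + (real (?D H) * ln r - real (?cl (proj n H)) * ln (1 + r))"
        using q r by (simp add: Q_def R_def ln_mult ln_div ln_realpow)
      then show "real (d choose 2) * ln q * real (card H)
          - real (n choose 2) * q + ln r * real (?D H) - r * real (?cl (proj n H)) \<le> ln (Q H)"
        using 1 2 3 by (simp add: mult_ac)
    qed
  qed auto
  also note gibbs
  \<comment> \<open>The entropy is at least \<open>ln (1 / p)\<close> times the expected number of
    hyperedges.\<close>
  also have "measure_pmf.expectation M (\<lambda>H. ln (pmf M H)) \<le>
      measure_pmf.expectation M (\<lambda>H. ln p * real (card H))"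
  proof (rule integral_mono_AE)
    show "AE H in M. ln (pmf M H) \<le> ln p * real (card H)"
    proof (rule AE_pmfI)
      fix H assume H: "H \<in> set_pmf M"
      then have "pmf M H \<le> p ^ card H"
        using supp p unfolding M_def by (intro pmf_random_hypergraph_le) auto
      then have "ln (pmf M H) \<le> ln (p ^ card H)"
        using pmf_positive[OF H] p by (subst ln_le_cancel_iff) auto
      then show "ln (pmf M H) \<le> ln p * real (card H)"
        using p by (simp add: ln_realpow mult.commute)
    qed
  qed auto
  finally show ?thesis
    using p q r expectation_card_random_hypergraph[of p n d]
    by (simp add: M_def ln_div algebra_simps)
qed

section \<open>Bounds on the loss for fixed \<open>n\<close>, and the limit\<close>

lemma partial_recovery_loss_le_1:
  assumes "0 \<le> p" "p \<le> 1"
  shows "partial_recovery_loss n d p \<le> 1"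
proof -
  let ?M = "random_hypergraph n d p"
  let ?L = "\<lambda>B. measure_pmf.expectation ?M (\<lambda>H. real (card (sym_diff (B (proj n H)) H)))"
  define B where "B = (\<lambda>g\<in>projected_graphs n d. {} :: nat set set)"
  have "B \<in> recovery_maps n d"
    by (auto simp: B_def recovery_maps_def)
  then have "Min (?L ` recovery_maps n d) \<le> ?L B"
    using finite_recovery_maps by (intro Min_le) auto
  also have "?L B = measure_pmf.expectation ?M (\<lambda>H. real (card H))"
  proof (intro integral_cong_AE AE_pmfI)
    fix H assume "H \<in> set_pmf ?M"
    then have "proj n H \<in> projected_graphs n d"
      using set_random_hypergraph[of n d p] by (auto simp: projected_graphs_def)
    then show "real (card (sym_diff (B (proj n H)) H)) = real (card H)"
      by (simp add: B_def)
  qed auto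
  also have "\<dots> = p * real (n choose d)"
    using assms by (rule expectation_card_random_hypergraph)
  finally have "partial_recovery_loss n d p \<le> p * real (n choose d) / (p * real (n choose d))"
    unfolding partial_recovery_loss_def using assms by (intro divide_right_mono) auto
  \<comment> \<open>Equality fails when \<open>p = 0\<close> or \<open>n < d\<close>, where the
    quotient is \<open>0 / 0 = 0\<close>.\<close>
  also have "\<dots> \<le> 1"
    by (simp only: divide_self_if) simp
  finally show ?thesis .
qed

lemma real_choose_two: "real (s choose 2) = real s * (real s - 1) / 2"
  by (cases s) (auto simp: choose_two real_of_nat_div algebra_simps)

text \<open>
  The assumption \<open>(d - 1) / (d + 1) < \<delta>\<close> is equivalent to the positivity of \<open>a\<close>.
\<close>
lemma partial_recovery_loss_ge:
  fixes d n :: nat and c1 c2 \<delta> p :: real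
  assumes d: "d \<ge> 3" and \<delta>: "(real d - 1) / (real d + 1) < \<delta>" "\<delta> < 1"
    and n: "n \<ge> d" and c: "0 < c1" "0 < c2" and p1: "p \<le> 1"
    and lo: "c1 * real n powr (- real d + 1 + \<delta>) \<le> p"
    and hi: "p \<le> c2 * real n powr (- real d + 1 + \<delta>)"
  defines "a \<equiv> real d - 1 - \<delta> - real (d choose 2) * (1 - \<delta>)"
  defines "K \<equiv> 2 ^ 2 ^ d * max 1 c2 ^ 2 ^ d"
  shows "a > 0"
    and "1 - (ln c2 + (1 + K) * real d ^ d / c1) / (a * ln (real n))
         \<le> partial_recovery_loss n d p"
proof -
  have \<delta>d: "(1 - \<delta>) * (real d + 1) < 2"
    using \<delta> by (simp add: field_simps)
  \<comment> \<open>Uses \<open>(d choose 2) - 1 = (d - 2) * (d + 1) / 2\<close> and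
    \<open>d - 1 - \<delta> = (d - 2) + (1 - \<delta>)\<close>.\<close>
  have a_eq: "a = (real d - 2) * (1 - (1 - \<delta>) * (real d + 1) / 2)"
    unfolding a_def real_choose_two by (simp add: field_simps)
  show a: "a > 0"
    unfolding a_eq using d \<delta>d by (intro mult_pos_pos) auto

  define N where "N = real n"
  have N: "N > 1" and n0: "0 < N"
    using n d by (auto simp: N_def)
  have lnN: "ln N > 0"
    using N by simp
  \<comment> \<open>\<open>q\<close> is the order of \<open>n ^ (d - 2) * p\<close>, the expected
    number of hyperedges on a given pair; \<open>r\<close> is the inverse of the number of cliques
    per hyperedge.\<close>
  define q where "q = N powr (\<delta> - 1)"
  define r where "r = N powr (- a)"
  have q: "0 < q" "q \<le> 1" and r: "0 < r" "r \<le> 1"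
    using N a \<delta> powr_mono[of "\<delta> - 1" 0 N] powr_mono[of "- a" 0 N] by (auto simp: q_def r_def)
  have p0: "p > 0"
    by (rule less_le_trans[OF _ lo]) (use c n0 in \<open>simp add: N_def\<close>)
  have qpow: "q ^ k = N powr ((\<delta> - 1) * real k)" for k
    using n0 by (simp add: q_def powr_powr powr_realpow[symmetric])

  have trace: "real n ^ (d - s) * p \<le> max 1 c2 * q ^ (s choose 2)" if s: "2 \<le> s" "s \<le> d" for s
  proof -
    \<comment> \<open>The exponent inequality is the factorisation of \<open>a\<close> with
      \<open>s\<close> in place of \<open>d\<close>: an equality at \<open>s = 2\<close>, and
      otherwise implied by the threshold condition because \<open>s \<le> d\<close>.\<close>
    have "(1 - \<delta>) * (real s + 1) \<le> (1 - \<delta>) * (real d + 1)"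
      using s \<delta> by (intro mult_left_mono) auto
    then have "(real s - 2) * ((1 - \<delta>) * (real s + 1)) \<le> (real s - 2) * 2"
      using s \<delta>d by (intro mult_left_mono) auto
    then have e: "real (d - s) + (- real d + 1 + \<delta>) \<le> (\<delta> - 1) * real (s choose 2)"
      unfolding real_choose_two using s by (simp add: of_nat_diff field_simps)
    have "real n ^ (d - s) * p \<le> N powr real (d - s) * (c2 * N powr (- real d + 1 + \<delta>))"
      using hi n0 by (auto simp: N_def powr_realpow intro!: mult_left_mono)
    also have "\<dots> = c2 * N powr (real (d - s) + (- real d + 1 + \<delta>))"
      by (simp only: powr_add mult_ac)
    also have "\<dots> \<le> max 1 c2 * N powr ((\<delta> - 1) * real (s choose 2))"
      using e N c by (intro mult_mono powr_mono) auto
    finally show ?thesis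
      by (simp add: qpow)
  qed

  define M where "M = p * real (n choose d)"
  define cl where "cl = measure_pmf.expectation (random_hypergraph n d p)
                          (\<lambda>H. real (card (cliques n d (proj n H))))"
  have nd: "real (n choose d) \<le> N powr real d"
    using binomial_le_pow[OF n] n0
    by (simp add: N_def powr_realpow flip: of_nat_power)
  have n2: "real (n choose 2) \<le> N powr 2"
    using binomial_le_pow[of 2 n] n d n0
    by (simp add: N_def powr_numeral flip: of_nat_power)
  \<comment> \<open>The remaining costs are of order \<open>N powr (1 + \<delta>)\<close>; a lower
    bound on \<open>M\<close> of this order lets them be absorbed as \<open>O(M)\<close>.\<close>
  have "(N / real d) ^ d \<le> real (n choose d)"
    using binomial_ge_n_over_k_pow_k[OF n, where ?'a = real] by (simp add: N_def)
  then have "(c1 * N powr (- real d + 1 + \<delta>)) * (N powr real d / real d ^ d) \<le> M"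
    unfolding M_def using lo n0 c p0
    by (intro mult_mono) (auto simp: N_def power_divide powr_realpow)
  also have "(c1 * N powr (- real d + 1 + \<delta>)) * (N powr real d / real d ^ d) =
             c1 / real d ^ d * N powr ((- real d + 1 + \<delta>) + real d)"
    unfolding powr_add[of N "- real d + 1 + \<delta>" "real d"]
    by (simp only: times_divide_eq_left times_divide_eq_right mult.assoc)
  also have "- real d + 1 + \<delta> + real d = 1 + \<delta>"
    by simp
  finally have M_ge: "c1 / real d ^ d * N powr (1 + \<delta>) \<le> M" .
  have "0 < c1 / real d ^ d * N powr (1 + \<delta>)"
    using c d n0 by (intro mult_pos_pos divide_pos_pos) auto
  with M_ge have M0: "M > 0"
    by linarith
  have M_ge': "N powr (1 + \<delta>) \<le> M * (real d ^ d / c1)"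
    using M_ge c d by (simp add: field_simps)

  have E1: "real (n choose 2) * q \<le> N powr (1 + \<delta>)"
  proof -
    have "real (n choose 2) * q \<le> N powr 2 * N powr (\<delta> - 1)"
      unfolding q_def using n2 by (intro mult_right_mono) auto
    also have "\<dots> = N powr (1 + \<delta>)"
      by (simp flip: powr_add)
    finally show ?thesis .
  qed
  \<comment> \<open>The exponent in the bound on the clique count exceeds
    \<open>1 + \<delta>\<close> by exactly \<open>a\<close>, which \<open>r\<close> cancels.\<close>
  have E2: "r * cl \<le> K * N powr (1 + \<delta>)"
  proof -
    have "cl \<le> real (n choose d) * (K * q ^ (d choose 2))"
      unfolding cl_def K_def using p0 p1 q trace by (intro expectation_card_cliques_le) auto
    also have "\<dots> \<le> N powr real d * (K * q ^ (d choose 2))"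
      using nd q by (intro mult_right_mono) (auto simp: K_def)
    finally have "r * cl \<le> r * (N powr real d * (K * q ^ (d choose 2)))"
      using r by (intro mult_left_mono) auto
    also have "\<dots> = K * N powr (- a + real d + (\<delta> - 1) * real (d choose 2))"
      by (simp only: r_def qpow powr_add mult_ac)
    also have "- a + real d + (\<delta> - 1) * real (d choose 2) = 1 + \<delta>"
      by (simp add: a_def algebra_simps)
    finally show ?thesis .
  qed
  \<comment> \<open>Per hyperedge, entropy minus graph cost is \<open>a * ln N\<close> up to a
    constant. The price \<open>ln (1 / r)\<close> of an error has the same coefficient, so the ratio
    tends to 1.\<close>
  have "ln p \<le> ln (c2 * N powr (- real d + 1 + \<delta>))"
    using hi p0 by (simp add: N_def)
  also have "\<dots> = ln c2 + (- real d + 1 + \<delta>) * ln N"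
    using c n0 by (simp add: ln_mult)
  finally have lnp: "a * ln N - ln c2 \<le> ln (1 / p) - real (d choose 2) * ln (1 / q)"
    using p0 n0 by (simp add: ln_div q_def a_def algebra_simps)

  have main: "1 - (ln c2 + (1 + K) * real d ^ d / c1) / (a * ln N) \<le> L / M"
    if B: "B \<in> recovery_maps n d" and L: "L = measure_pmf.expectation (random_hypergraph n d p)
             (\<lambda>H. real (card (sym_diff (B (proj n H)) H)))" for B L
  proof -
    \<comment> \<open>Dividing by \<open>a * ln N * M\<close> leaves a correction of order
      \<open>1 / ln N\<close>.\<close>
    have "M * (a * ln N - ln c2) \<le> M * (ln (1 / p) - real (d choose 2) * ln (1 / q))"
      using lnp M0 by (intro mult_left_mono) auto
    also have "\<dots> \<le> real (n choose 2) * q + r * cl + ln (1 / r) * L"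
      unfolding L M_def cl_def using p0 p1 q r B by (rule recovery_information_inequality)
    also have "\<dots> \<le> (1 + K) * N powr (1 + \<delta>) + a * ln N * L"
      using E1 E2 n0 by (simp add: r_def ln_div algebra_simps)
    also have "\<dots> \<le> (1 + K) * (M * (real d ^ d / c1)) + a * ln N * L"
      using M_ge' by (intro add_right_mono mult_left_mono) (auto simp: K_def)
    finally have "a * ln N * M - (ln c2 + (1 + K) * real d ^ d / c1) * M \<le> a * ln N * L"
      by (simp add: algebra_simps)
    then have "(a * ln N - (ln c2 + (1 + K) * real d ^ d / c1)) / (a * ln N) \<le> L / M"
      using a lnN M0 by (simp add: pos_divide_le_eq pos_le_divide_eq algebra_simps)
    then show ?thesis
      using a lnN by (simp add: diff_divide_distrib)
  qed
  define L where "L = (\<lambda>B. measure_pmf.expectation (random_hypergraph n d p)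
                    (\<lambda>H. real (card (sym_diff (B (proj n H)) H))))"
  have "Min (L ` recovery_maps n d) \<in> L ` recovery_maps n d"
    using finite_recovery_maps recovery_maps_nonempty by (intro Min_in) auto
  then obtain B where B: "B \<in> recovery_maps n d" and "Min (L ` recovery_maps n d) = L B"
    by auto
  then have "partial_recovery_loss n d p = L B / M"
    by (simp add: partial_recovery_loss_def L_def M_def)
  then show "1 - (ln c2 + (1 + K) * real d ^ d / c1) / (a * ln (real n))
             \<le> partial_recovery_loss n d p"
    using main[OF B refl] by (simp add: L_def N_def)
qed

theorem theorem11:
  fixes d :: nat and c \<delta> :: real and p :: "nat \<Rightarrow> real"
  assumes "d \<ge> 3" and "c > 0"
    and "(real d - 1) / (real d + 1) < \<delta>" and "\<delta> < 1"
    and "(\<lambda>n. p n / real n powr (- real d + 1 + \<delta>)) \<longlonglongrightarrow> c"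
  shows "(\<lambda>n. partial_recovery_loss n d (p n)) \<longlonglongrightarrow> 1"
proof -
  let ?f = "\<lambda>n. real n powr (- real d + 1 + \<delta>)"
  define a where "a = real d - 1 - \<delta> - real (d choose 2) * (1 - \<delta>)"
  \<comment> \<open>The constant of the lower bound for \<open>c1 = c / 2\<close> and
    \<open>c2 = 2 * c\<close>, which eventually enclose the ratio of \<open>p n\<close> to
    \<open>?f n\<close>.\<close>
  define A where "A = ln (2 * c) + (1 + 2 ^ 2 ^ d * max 1 (2 * c) ^ 2 ^ d) * real d ^ d / (c / 2)"
  \<comment> \<open>The exponent is negative, so \<open>p\<close> tends to 0 and is eventually a
    genuine probability.\<close>
  have "(\<lambda>n. p n / ?f n * ?f n) \<longlonglongrightarrow> c * 0"
    using assms(1,4)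
    by (intro tendsto_mult assms(5) tendsto_neg_powr filterlim_real_sequentially) auto
  moreover have "\<forall>\<^sub>F n in sequentially. p n / ?f n * ?f n = p n"
    using eventually_gt_at_top[of 0] by eventually_elim auto
  ultimately have "p \<longlonglongrightarrow> 0"
    using Lim_transform_eventually by fastforce
  then have p1: "\<forall>\<^sub>F n in sequentially. p n < 1"
    by (rule order_tendstoD) simp
  have lo: "\<forall>\<^sub>F n in sequentially. c / 2 < p n / ?f n"
    and hi: "\<forall>\<^sub>F n in sequentially. p n / ?f n < 2 * c"
    by (rule order_tendstoD[OF assms(5)], use assms(2) in simp)+
  \<comment> \<open>\<open>a > 0\<close> does not depend on \<open>n\<close>, but is obtained from a
    lemma about some large \<open>n\<close>; it is extracted afterwards.\<close>
  have ev: "\<forall>\<^sub>F n in sequentially.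
      a > 0 \<and> 1 - A / (a * ln (real n)) \<le> partial_recovery_loss n d (p n) \<and>
      partial_recovery_loss n d (p n) \<le> 1"
    using p1 lo hi eventually_ge_at_top[of d] eventually_gt_at_top[of 0]
  proof eventually_elim
    case (elim n)
    then have f: "?f n > 0"
      by simp
    then have b: "c / 2 * ?f n \<le> p n" "p n \<le> 2 * c * ?f n"
      using elim by (simp_all add: pos_less_divide_eq pos_divide_less_eq less_imp_le)
    then have "p n \<ge> 0"
      using f assms(2) by (smt (verit) half_gt_zero mult_pos_pos)
    then show ?case
      using partial_recovery_loss_ge[OF assms(1,3,4), of n "c / 2" "2 * c" "p n"]
        partial_recovery_loss_le_1[of "p n" n d] b elim assms(2)
      unfolding a_def A_def by simp
  qed
  then have a: "a > 0"
    using eventually_happens by fastforce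
  have "filterlim (\<lambda>n. a * ln (real n)) at_top sequentially"
    using a by (intro filterlim_tendsto_pos_mult_at_top[OF tendsto_const]
        filterlim_compose[OF ln_at_top] filterlim_real_sequentially)
  then have "(\<lambda>n. 1 - A / (a * ln (real n))) \<longlonglongrightarrow> 1 - 0"
    by (rule tendsto_diff[OF tendsto_const tendsto_divide_0[OF tendsto_const
          filterlim_at_top_imp_at_infinity]])
  then have "(\<lambda>n. 1 - A / (a * ln (real n))) \<longlonglongrightarrow> 1"
    by simp
  then show ?thesis
    by (rule tendsto_sandwich[rotated 2, OF _ tendsto_const]) (rule eventually_mono[OF ev], simp)+
qed

end
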